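(* Up to naming of the multiplicative inverse operation (i.e. identifying the operator symbols ${}^{\sim}$ and ${}^{-1}$), the equational theory of one-based non-involutive meadows and the equational theory of one-totalized fields are the same: an equation between terms holds in all one-based non-involutive meadows if and only if it holds in all one-totalized fields.
   Context: All algebras are total. Terms are built from constants $0,1$, binary $+,\cdot$, unary additive inverse $-$, and one unary postfix inverse operator (written ${}^{\sim}$ for one-based non-involutive meadows and ${}^{-1}$ for totalized fields); $p-q$ abbreviates $p+(-q)$. Equations are understood as universally quantified. A one-based non-involutive meadow is an algebra over $\{0,1,+,\cdot,-,{}^{\sim}\}$ that is a commutative ring with multiplicative identity $1$ (the case $0=1$ is allowed) and satisfies $(x^{\sim})^{\sim}=x+(1-x\cdot x^{\sim})$, $x\cdot(x\cdot x^{\sim})=x$, $x^{\sim}\cdot(x^{\sim})^{\sim}=1$, and $(x\cdot(x^{\sim}\cdot x^{\sim}))^{\sim}\cdot(x\cdot x^{\sim})=x$. A totalized field is an algebra over $\{0,1,+,\cdot,-,{}^{-1}\}$ that is a commutative ring with multiplicative identity $1$ and satisfies the separation axiom $0\neq 1$ and the general inverse law $x\neq 0\Rightarrow x\cdot x^{-1}=1$. A one-totalized field is a totalized field that satisfies in addition $0^{-1}=1$. *)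

theory Defs
  imports "HOL-Algebra.Ring"
begin

text \<open>
  Algebras are rings with an explicit carrier together with a total unary operation, which plays
  the role of both inverse symbols. Additive inverse is not a record field: in a ring it is
  determined by the other operations, and it is interpreted by the derived operation of
  \<^locale>\<open>ring\<close>.
\<close>

record 'a inv_ring = "'a ring" +
  tinv :: "'a \<Rightarrow> 'a"  ("_\<^sup>\<sim>\<index>" [1000] 999)

locale one_based_noninvolutive_meadow = cring R
  for R :: "('a, 'm) inv_ring_scheme" (structure) +
  assumes tinv_closed: "x \<in> carrier R \<Longrightarrow> x\<^sup>\<sim> \<in> carrier R"
    and tinv_tinv: "x \<in> carrier R \<Longrightarrow> (x\<^sup>\<sim>)\<^sup>\<sim> = x \<oplus> (\<one> \<ominus> x \<otimes> x\<^sup>\<sim>)"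
    and mult_mult_tinv: "x \<in> carrier R \<Longrightarrow> x \<otimes> (x \<otimes> x\<^sup>\<sim>) = x"
    and tinv_mult_tinv_tinv: "x \<in> carrier R \<Longrightarrow> x\<^sup>\<sim> \<otimes> (x\<^sup>\<sim>)\<^sup>\<sim> = \<one>"
    and tinv_recover: "x \<in> carrier R \<Longrightarrow> (x \<otimes> (x\<^sup>\<sim> \<otimes> x\<^sup>\<sim>))\<^sup>\<sim> \<otimes> (x \<otimes> x\<^sup>\<sim>) = x"

locale totalized_field = cring R
  for R :: "('a, 'm) inv_ring_scheme" (structure) +
  assumes tinv_closed: "x \<in> carrier R \<Longrightarrow> x\<^sup>\<sim> \<in> carrier R"
    and separation: "\<zero> \<noteq> \<one>"
    and general_inverse: "x \<in> carrier R \<Longrightarrow> x \<noteq> \<zero> \<Longrightarrow> x \<otimes> x\<^sup>\<sim> = \<one>"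

locale one_totalized_field = totalized_field R
  for R :: "('a, 'm) inv_ring_scheme" (structure) +
  assumes tinv_zero: "\<zero>\<^sup>\<sim> = \<one>"

datatype 'v trm =
    Var 'v
  | Zero
  | One
  | Add "'v trm" "'v trm"
  | Mul "'v trm" "'v trm"
  | Neg "'v trm"
  | Inv "'v trm"

primrec eval :: "('a, 'm) inv_ring_scheme \<Rightarrow> ('v \<Rightarrow> 'a) \<Rightarrow> 'v trm \<Rightarrow> 'a" where
  "eval R \<rho> (Var v) = \<rho> v"
| "eval R \<rho> Zero = \<zero>\<^bsub>R\<^esub>"
| "eval R \<rho> One = \<one>\<^bsub>R\<^esub>"
| "eval R \<rho> (Add s t) = eval R \<rho> s \<oplus>\<^bsub>R\<^esub> eval R \<rho> t"
| "eval R \<rho> (Mul s t) = eval R \<rho> s \<otimes>\<^bsub>R\<^esub> eval R \<rho> t"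
| "eval R \<rho> (Neg t) = \<ominus>\<^bsub>R\<^esub> eval R \<rho> t"
| "eval R \<rho> (Inv t) = (eval R \<rho> t)\<^sup>\<sim>\<^bsub>R\<^esub>"

type_synonym 'v equation = "'v trm \<times> 'v trm"

definition satisfies :: "('a, 'm) inv_ring_scheme \<Rightarrow> 'v equation \<Rightarrow> bool" where
  "satisfies R e \<longleftrightarrow>
     (\<forall>\<rho>. range \<rho> \<subseteq> carrier R \<longrightarrow> eval R \<rho> (fst e) = eval R \<rho> (snd e))"

text \<open>
  HOL cannot quantify over types inside a formula, so each theory is relative to a type from
  which the carriers (arbitrary subsets of that type) are drawn. Such a type has to be infinite
  for the theory to be the intended one: the only algebras over \<^typ>\<open>bool\<close>, say, have at most two
  elements, hence satisfy further equations. Every algebra over whatever type has a copy with its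
  carrier in some infinite type, so a statement about all infinite types covers all algebras.
\<close>

definition meadow_equational_theory :: "'a itself \<Rightarrow> 'v equation set" where
  "meadow_equational_theory (_ :: 'a itself) =
     {e. \<forall>R :: 'a inv_ring. one_based_noninvolutive_meadow R \<longrightarrow> satisfies R e}"

definition one_totalized_field_equational_theory :: "'a itself \<Rightarrow> 'v equation set" where
  "one_totalized_field_equational_theory (_ :: 'a itself) =
     {e. \<forall>R :: 'a inv_ring. one_totalized_field R \<longrightarrow> satisfies R e}"

end

theory Submission
  imports "HOL-Algebra.Ring_Divisibility" "HOL-Library.Countable_Set" Defs
begin

text \<open>
  In a meadow, \<open>e = x \<otimes> x\<^sup>\<sim>\<close> is idempotent and \<open>x\<^sup>\<sim>\<close> agrees with \<open>\<one>\<close> on the factor \<open>\<one> \<ominus> e\<close>. Every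
  ring homomorphism from a meadow to a one-totalized field therefore preserves \<open>\<sim>\<close>: it sends \<open>e\<close> to
  \<open>\<zero>\<close> if it kills \<open>x\<close>, and to \<open>\<one>\<close> otherwise. If \<open>d \<noteq> \<zero>\<close>, then
  \<open>\<one> \<ominus> d \<otimes> d\<^sup>\<sim>\<close> generates a proper ideal, and a maximal ideal above it does not contain \<open>d\<close>, so an
  equation that fails in a meadow fails in a residue field. Conversely, one-totalized fields are
  meadows. The change of the carrier type is an instance of the downward Loewenheim-Skolem argument.
\<close>

section \<open>Terms, evaluation and homomorphisms\<close>

instance trm :: (countable) countable
  by countable_datatype

lemma finite_set_trm [simp]: "finite (set_trm t)"
  by (induction t) auto

lemma eval_cong:
  assumes "\<And>v. v \<in> set_trm t \<Longrightarrow> \<rho> v = \<rho>' v"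
  shows "eval R \<rho> t = eval R \<rho>' t"
  using assms by (induction t) auto

lemma eval_closed:
  fixes R (structure)
  assumes "cring R" "\<And>x. x \<in> carrier R \<Longrightarrow> x\<^sup>\<sim> \<in> carrier R" "range \<rho> \<subseteq> carrier R"
  shows "eval R \<rho> t \<in> carrier R"
proof -
  interpret cring R by fact
  show ?thesis
    using assms(3) by (induction t) (auto simp: assms(2))
qed

text \<open>Ring homomorphisms already respect \<open>Neg\<close>, so only compatibility with
  \<open>tinv\<close> is added. Closure is asked of the source alone: it keeps all values of terms
  where \<open>h\<close> is known to be a homomorphism.\<close>

locale inv_ring_hom = ring_hom_cring R S h
  for R :: "('a, 'm) inv_ring_scheme" (structure)
    and S :: "('b, 'n) inv_ring_scheme" (structure) and h +
  assumes tinv_closed: "x \<in> carrier R \<Longrightarrow> x\<^sup>\<sim> \<in> carrier R"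
    and hom_tinv: "x \<in> carrier R \<Longrightarrow> h (x\<^sup>\<sim>) = (h x)\<^sup>\<sim>\<^bsub>S\<^esub>"
begin

lemma hom_eval:
  assumes "range \<rho> \<subseteq> carrier R"
  shows "h (eval R \<rho> t) = eval S (h \<circ> \<rho>) t"
proof -
  have "eval R \<rho> s \<in> carrier R" for s
    using R.is_cring tinv_closed assms by (rule eval_closed)
  then show ?thesis
    by (induction t) (simp_all add: hom_tinv)
qed

end

section \<open>Transport of structure along an injection\<close>

text \<open>If \<open>g\<close> is injective on \<open>A\<close> and its image is a subalgebra of
  \<open>R\<close>, this is an isomorphic copy of that subalgebra, with carrier in another
  type.\<close>

definition pullback :: "('b \<Rightarrow> 'a) \<Rightarrow> 'b set \<Rightarrow> ('a, 'm) inv_ring_scheme \<Rightarrow> 'b inv_ring" where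
  "pullback g A R = \<lparr>carrier = A,
     mult = (\<lambda>x y. inv_into A g (g x \<otimes>\<^bsub>R\<^esub> g y)), one = inv_into A g \<one>\<^bsub>R\<^esub>,
     zero = inv_into A g \<zero>\<^bsub>R\<^esub>, add = (\<lambda>x y. inv_into A g (g x \<oplus>\<^bsub>R\<^esub> g y)),
     tinv = (\<lambda>x. inv_into A g ((g x)\<^sup>\<sim>\<^bsub>R\<^esub>))\<rparr>"

text \<open>Closure of the image makes \<open>inv_into A g\<close> a true preimage of every result,
  so \<open>g\<close> commutes with the operations. Each ring law is then checked after applying
  \<open>g\<close>, in \<open>R\<close>, and pulled back by injectivity.\<close>

lemma pullback_inv_ring_hom:
  fixes R (structure)
  assumes "cring R" and g: "inj_on g A" "g ` A \<subseteq> carrier R"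
    and zero: "\<zero> \<in> g ` A" and one: "\<one> \<in> g ` A"
    and add: "\<And>x y. x \<in> A \<Longrightarrow> y \<in> A \<Longrightarrow> g x \<oplus> g y \<in> g ` A"
    and mult: "\<And>x y. x \<in> A \<Longrightarrow> y \<in> A \<Longrightarrow> g x \<otimes> g y \<in> g ` A"
    and neg: "\<And>x. x \<in> A \<Longrightarrow> \<ominus> g x \<in> g ` A"
    and tinv: "\<And>x. x \<in> A \<Longrightarrow> (g x)\<^sup>\<sim> \<in> g ` A"
  shows "inv_ring_hom (pullback g A R) R g"
proof -
  interpret cring R by fact
  let ?S = "pullback g A R"
  have carrier: "carrier ?S = A"
    by (simp add: pullback_def)
  have closed: "\<zero>\<^bsub>?S\<^esub> \<in> A" "\<one>\<^bsub>?S\<^esub> \<in> A" "\<And>x y. x \<in> A \<Longrightarrow> y \<in> A \<Longrightarrow> x \<oplus>\<^bsub>?S\<^esub> y \<in> A"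
    "\<And>x y. x \<in> A \<Longrightarrow> y \<in> A \<Longrightarrow> x \<otimes>\<^bsub>?S\<^esub> y \<in> A" "\<And>x. x \<in> A \<Longrightarrow> x\<^sup>\<sim>\<^bsub>?S\<^esub> \<in> A"
    using zero one add mult tinv by (simp_all add: pullback_def inv_into_into)
  have hom: "g \<zero>\<^bsub>?S\<^esub> = \<zero>" "g \<one>\<^bsub>?S\<^esub> = \<one>"
    "\<And>x y. x \<in> A \<Longrightarrow> y \<in> A \<Longrightarrow> g (x \<oplus>\<^bsub>?S\<^esub> y) = g x \<oplus> g y"
    "\<And>x y. x \<in> A \<Longrightarrow> y \<in> A \<Longrightarrow> g (x \<otimes>\<^bsub>?S\<^esub> y) = g x \<otimes> g y"
    "\<And>x. x \<in> A \<Longrightarrow> g (x\<^sup>\<sim>\<^bsub>?S\<^esub>) = (g x)\<^sup>\<sim>"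
    using zero one add mult tinv by (simp_all add: pullback_def f_inv_into_f)
  have g_carrier [simp]: "g x \<in> carrier R" if "x \<in> A" for x
    using g that by auto
  have eqI: "x = y" if "x \<in> A" "y \<in> A" "g x = g y" for x y
    using g that by (auto dest: inj_onD)
  have "cring ?S"
  proof (rule cringI)
    show "abelian_group ?S"
    proof (rule abelian_groupI, unfold carrier)
      fix x assume x: "x \<in> A"
      then obtain y where y: "y \<in> A" "g y = \<ominus> g x"
        using neg[OF x] by (metis imageE)
      show "\<exists>y\<in>A. y \<oplus>\<^bsub>?S\<^esub> x = \<zero>\<^bsub>?S\<^esub>"
        by (rule bexI[OF _ y(1)], rule eqI) (use x y in \<open>simp_all add: closed hom l_neg\<close>)
    qed (rule closed eqI; simp add: closed hom a_ac)+
    show "comm_monoid ?S"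
      by (rule comm_monoidI; unfold carrier; (rule closed eqI; simp add: closed hom m_ac))
    show "(x \<oplus>\<^bsub>?S\<^esub> y) \<otimes>\<^bsub>?S\<^esub> z = x \<otimes>\<^bsub>?S\<^esub> z \<oplus>\<^bsub>?S\<^esub> y \<otimes>\<^bsub>?S\<^esub> z"
      if "x \<in> carrier ?S" "y \<in> carrier ?S" "z \<in> carrier ?S" for x y z
      using that unfolding carrier by (intro eqI) (simp_all add: closed hom l_distr)
  qed
  then interpret S: cring ?S .
  show ?thesis
    by unfold_locales (auto simp: carrier closed hom ring_hom_def)
qed

text \<open>Injectivity acts twice: it keeps the images of nonzero elements nonzero, so that the
  inverse law of \<open>R\<close> applies, and it reflects the resulting equations to
  \<open>S\<close>.\<close>

lemma one_totalized_field_inj_hom: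
  assumes "inv_ring_hom S R h" "inj_on h (carrier S)" "one_totalized_field R"
  shows "one_totalized_field S"
proof -
  interpret inv_ring_hom S R h by fact
  interpret F: one_totalized_field R by fact
  note eqI = inj_onD[OF assms(2)]
  show ?thesis
  proof unfold_locales
    show "\<zero>\<^bsub>S\<^esub> \<noteq> \<one>\<^bsub>S\<^esub>"
      using F.separation hom_zero hom_one by metis
    show "x \<otimes>\<^bsub>S\<^esub> x\<^sup>\<sim>\<^bsub>S\<^esub> = \<one>\<^bsub>S\<^esub>" if x: "x \<in> carrier S" "x \<noteq> \<zero>\<^bsub>S\<^esub>" for x
    proof -
      have "h x \<noteq> \<zero>\<^bsub>R\<^esub>"
        using x eqI[of x "\<zero>\<^bsub>S\<^esub>"] by auto
      then show ?thesis
        using x by (intro eqI) (simp_all add: tinv_closed hom_tinv F.general_inverse)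
    qed
    show "\<zero>\<^bsub>S\<^esub>\<^sup>\<sim>\<^bsub>S\<^esub> = \<one>\<^bsub>S\<^esub>"
      by (intro eqI) (simp_all add: tinv_closed hom_tinv F.tinv_zero)
  qed (simp add: tinv_closed)
qed

section \<open>Countable subalgebras over an infinite type\<close>

lemma countable_inj_on_infinite:
  assumes "countable T" "infinite (UNIV :: 'b set)"
  obtains g :: "'b \<Rightarrow> 'a" and A where "inj_on g A" "g ` A = T"
proof -
  obtain c :: "nat \<Rightarrow> 'b" where "inj c"
    using assms(2) infinite_countable_subset by blast
  then have "inj_on (c \<circ> to_nat_on T) T"
    using assms(1) by (intro comp_inj_on inj_on_to_nat_on) (auto intro: inj_on_subset)
  \<comment> \<open>The map \<open>g\<close> is the inverse of the embedding of \<open>T\<close>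
    through the naturals into \<open>'b\<close>, and \<open>A\<close> is the image of that
    embedding.\<close>
  then have "bij_betw (inv_into T (c \<circ> to_nat_on T)) ((c \<circ> to_nat_on T) ` T) T"
    by (intro bij_betw_inv_into inj_on_imp_bij_betw)
  then show ?thesis
    using that by (auto simp: bij_betw_def)
qed

text \<open>The carrier of the copy is the countable subalgebra generated by the variables of \<open>e\<close>.\<close>

lemma one_totalized_field_copy:
  fixes R :: "('a, 'm) inv_ring_scheme"
  assumes "one_totalized_field R" "\<not> satisfies R e" "infinite (UNIV :: 'b set)"
  shows "\<exists>S :: 'b inv_ring. one_totalized_field S \<and> \<not> satisfies S e"
proof -
  interpret one_totalized_field R by fact
  obtain \<rho>\<^sub>0 where \<rho>\<^sub>0: "range \<rho>\<^sub>0 \<subseteq> carrier R" "eval R \<rho>\<^sub>0 (fst e) \<noteq> eval R \<rho>\<^sub>0 (snd e)"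
    using assms(2) by (auto simp: satisfies_def)
  define V where "V = set_trm (fst e) \<union> set_trm (snd e)"
  \<comment> \<open>Variables outside the equation do not affect its two sides; sending them all to
    zero makes the range finite, even if \<open>'v\<close> is uncountable.\<close>
  define \<rho> where "\<rho> v = (if v \<in> V then \<rho>\<^sub>0 v else \<zero>\<^bsub>R\<^esub>)" for v
  have \<rho>: "range \<rho> \<subseteq> carrier R" "eval R \<rho> (fst e) \<noteq> eval R \<rho> (snd e)"
    using \<rho>\<^sub>0 eval_cong[of "fst e" \<rho> \<rho>\<^sub>0 R] eval_cong[of "snd e" \<rho> \<rho>\<^sub>0 R]
    by (auto simp: \<rho>_def V_def)
  have "range \<rho> \<subseteq> insert \<zero>\<^bsub>R\<^esub> (\<rho>\<^sub>0 ` V)"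
    by (auto simp: \<rho>_def)
  then have "finite (range \<rho>)"
    by (rule finite_subset) (simp add: V_def)
  \<comment> \<open>Naming the same generators by naturals leaves only countably many terms, so the
    subalgebra \<open>T\<close> of their values is countable.\<close>
  then have "range (from_nat_into (range \<rho>)) = range \<rho>"
    by (intro range_from_nat_into) (simp_all add: countable_finite)
  then obtain \<sigma> :: "nat \<Rightarrow> 'a" where \<sigma>: "range \<sigma> = range \<rho>" ..
  define T where "T = range (eval R \<sigma>)"
  have T: "\<exists>t. x = eval R \<sigma> t" if "x \<in> T" for x
    using that by (auto simp: T_def)
  have TI: "eval R \<sigma> t \<in> T" for t
    by (simp add: T_def)
  have "countable T"
    by (simp add: T_def)
  then obtain g :: "'b \<Rightarrow> 'a" and A where g: "inj_on g A" "g ` A = T"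
    using assms(3) by (rule countable_inj_on_infinite)
  have gT: "g x \<in> T" if "x \<in> A" for x
    using g that by auto
  have "inv_ring_hom (pullback g A R) R g"
  proof (rule pullback_inv_ring_hom, unfold g(2))
    show "T \<subseteq> carrier R"
      using eval_closed[OF is_cring tinv_closed, of \<sigma>] \<sigma> \<rho>(1) by (auto simp: T_def)
    show "\<zero>\<^bsub>R\<^esub> \<in> T" "\<one>\<^bsub>R\<^esub> \<in> T"
      using TI[of Zero] TI[of One] by simp_all
    fix x y assume "x \<in> A" "y \<in> A"
    then obtain s t where "g x = eval R \<sigma> s" "g y = eval R \<sigma> t"
      using T gT by meson
    then show "g x \<oplus>\<^bsub>R\<^esub> g y \<in> T" "g x \<otimes>\<^bsub>R\<^esub> g y \<in> T"
      using TI[of "Add s t"] TI[of "Mul s t"] by simp_all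
  next
    fix x assume "x \<in> A"
    then obtain s where "g x = eval R \<sigma> s"
      using T gT by meson
    then show "\<ominus>\<^bsub>R\<^esub> g x \<in> T" "(g x)\<^sup>\<sim>\<^bsub>R\<^esub> \<in> T"
      using TI[of "Neg s"] TI[of "Inv s"] by simp_all
  qed (use g is_cring in auto)
  then interpret G: inv_ring_hom "pullback g A R" R g .
  have carrier: "carrier (pullback g A R) = A"
    by (simp add: pullback_def)
  have "\<rho> v \<in> g ` A" for v
  proof -
    obtain n where "\<rho> v = \<sigma> n"
      using \<sigma> by (metis rangeE rangeI)
    then show ?thesis
      using TI[of "Var n"] g by simp
  qed
  \<comment> \<open>The lifted valuation refutes the equation in the copy: \<open>g\<close> maps its
    values of the two sides to those under \<open>\<rho>\<close>, which differ.\<close>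
  then have "range (inv_into A g \<circ> \<rho>) \<subseteq> carrier (pullback g A R)" "g \<circ> (inv_into A g \<circ> \<rho>) = \<rho>"
    by (auto simp: carrier inv_into_into f_inv_into_f fun_eq_iff)
  then have "\<not> satisfies (pullback g A R) e"
    using G.hom_eval \<rho>(2) unfolding satisfies_def by metis
  moreover have "one_totalized_field (pullback g A R)"
    using G.inv_ring_hom_axioms assms(1) g(1)
    by (intro one_totalized_field_inj_hom[of _ R g]) (simp_all add: carrier)
  ultimately show ?thesis
    by blast
qed

section \<open>One-totalized fields are meadows\<close>

lemma (in one_totalized_field) tinv_one: "\<one>\<^sup>\<sim> = \<one>"
  using general_inverse[of \<one>] separation tinv_closed[of \<one>] by simp

lemma (in totalized_field) tinv_unique:
  assumes "x \<in> carrier R" "y \<in> carrier R" "x \<otimes> y = \<one>"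
  shows "x\<^sup>\<sim> = y"
proof -
  have "x \<noteq> \<zero>"
    using assms separation by auto
  then show ?thesis
    using assms general_inverse[of x] tinv_closed[of x] by (metis m_assoc m_comm r_one)
qed

text \<open>At zero, \<open>x \<otimes> x\<^sup>\<sim>\<close> is zero and both
  \<open>x\<^sup>\<sim>\<close> and its inverse are one. Elsewhere
  \<open>x \<otimes> x\<^sup>\<sim>\<close> is one, the correction term
  \<open>\<one> \<ominus> x \<otimes> x\<^sup>\<sim>\<close> vanishes and inversion is
  involutive.\<close>

sublocale one_totalized_field \<subseteq> one_based_noninvolutive_meadow
proof unfold_locales
  fix x assume x: "x \<in> carrier R"
  consider "x = \<zero>" | "x \<noteq> \<zero>" by blast
  then have "(x\<^sup>\<sim>)\<^sup>\<sim> = x \<oplus> (\<one> \<ominus> x \<otimes> x\<^sup>\<sim>) \<and> x \<otimes> (x \<otimes> x\<^sup>\<sim>) = x \<and> x\<^sup>\<sim> \<otimes> (x\<^sup>\<sim>)\<^sup>\<sim> = \<one> \<and>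
    (x \<otimes> (x\<^sup>\<sim> \<otimes> x\<^sup>\<sim>))\<^sup>\<sim> \<otimes> (x \<otimes> x\<^sup>\<sim>) = x"
  proof cases
    case 1
    then show ?thesis
      by (simp add: tinv_zero tinv_one minus_eq)
  next
    case 2
    have inv: "x \<otimes> x\<^sup>\<sim> = \<one>" "x\<^sup>\<sim> \<otimes> x = \<one>" "x\<^sup>\<sim> \<in> carrier R"
      using x 2 general_inverse tinv_closed m_comm by auto
    then have "(x\<^sup>\<sim>)\<^sup>\<sim> = x"
      using x by (intro tinv_unique) auto
    moreover have "x \<otimes> (x\<^sup>\<sim> \<otimes> x\<^sup>\<sim>) = x\<^sup>\<sim>"
      using x inv m_assoc[of x "x\<^sup>\<sim>" "x\<^sup>\<sim>"] by simp
    ultimately show ?thesis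
      using x inv by (simp add: minus_eq r_neg)
  qed
  then show "(x\<^sup>\<sim>)\<^sup>\<sim> = x \<oplus> (\<one> \<ominus> x \<otimes> x\<^sup>\<sim>)" "x \<otimes> (x \<otimes> x\<^sup>\<sim>) = x" "x\<^sup>\<sim> \<otimes> (x\<^sup>\<sim>)\<^sup>\<sim> = \<one>"
    "(x \<otimes> (x\<^sup>\<sim> \<otimes> x\<^sup>\<sim>))\<^sup>\<sim> \<otimes> (x \<otimes> x\<^sup>\<sim>) = x"
    by blast+
qed (rule tinv_closed)

section \<open>Totalized fields and maximal ideals\<close>

definition totalize :: "('a, 'm) ring_scheme \<Rightarrow> 'a inv_ring" where
  "totalize K = \<lparr>carrier = carrier K, mult = mult K, one = one K, zero = zero K, add = add K,
     tinv = (\<lambda>x. if x = \<zero>\<^bsub>K\<^esub> then \<one>\<^bsub>K\<^esub> else inv\<^bsub>K\<^esub> x)\<rparr>"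

lemma one_totalized_field_totalize:
  assumes "field K"
  shows "one_totalized_field (totalize K)"
proof -
  interpret field K by fact
  have "cring (totalize K)"
    by (intro cringI abelian_groupI comm_monoidI)
      (auto simp: totalize_def a_ac m_assoc l_distr intro: l_neg m_comm)
  then interpret T: cring "totalize K" .
  show ?thesis
    by unfold_locales (auto simp: totalize_def field_Units)
qed

text \<open>Krull's theorem, by Zorn's lemma on the ideals above \<open>J\<close> that avoid
  \<open>\<one>\<close>: the union of a nonempty chain of them is again one. An ideal strictly above
  a maximal such \<open>M\<close> must contain \<open>\<one>\<close> and is therefore the whole
  ring.\<close>

lemma (in cring) exists_maximalideal:
  assumes "ideal J R" "\<one> \<notin> J"
  shows "\<exists>M. maximalideal M R \<and> J \<subseteq> M"
proof -
  define P where "P = {I. ideal I R \<and> J \<subseteq> I \<and> \<one> \<notin> I}"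
  have "\<exists>M\<in>P. \<forall>X\<in>P. M \<subseteq> X \<longrightarrow> X = M"
  proof (rule subset_Zorn_nonempty)
    show "P \<noteq> {}"
      using assms by (auto simp: P_def)
    fix C assume C: "C \<noteq> {}" "subset.chain P C"
    then have "subset.chain {I. ideal I R} C"
      by (auto simp: P_def subset.chain_def)
    then have "ideal (\<Union>C) R"
      using chain_Union_is_ideal[of C] C(1) by simp
    then show "\<Union>C \<in> P"
      using C by (fastforce simp: P_def subset.chain_def)
  qed
  then obtain M where M: "ideal M R" "J \<subseteq> M" "\<one> \<notin> M"
    and max: "\<And>X. X \<in> P \<Longrightarrow> M \<subseteq> X \<Longrightarrow> X = M"
    by (auto simp: P_def)
  have "maximalideal M R"
  proof (rule maximalidealI)
    show "carrier R \<noteq> M"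
      using M(3) by blast
    show "X = M \<or> X = carrier R" if "ideal X R" "M \<subseteq> X" for X
      using that M(2) max[of X] ideal.one_imp_carrier[of X R] by (auto simp: P_def)
  qed (rule M(1))
  then show ?thesis
    using M(2) by blast
qed

section \<open>Homomorphisms from meadows to residue fields\<close>

context one_based_noninvolutive_meadow
begin

text \<open>On the part where \<open>x\<close> vanishes this forces \<open>x\<^sup>\<sim> = \<one>\<close>.\<close>

lemma mult_tinv_complement:
  assumes "x \<in> carrier R"
  shows "x \<otimes> x\<^sup>\<sim> \<oplus> x\<^sup>\<sim> \<otimes> (\<one> \<ominus> x \<otimes> x\<^sup>\<sim>) = \<one>"
proof -
  have "x\<^sup>\<sim> \<otimes> (x\<^sup>\<sim>)\<^sup>\<sim> = x\<^sup>\<sim> \<otimes> (x \<oplus> (\<one> \<ominus> x \<otimes> x\<^sup>\<sim>))"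
    using assms tinv_tinv by simp
  also have "\<dots> = x \<otimes> x\<^sup>\<sim> \<oplus> x\<^sup>\<sim> \<otimes> (\<one> \<ominus> x \<otimes> x\<^sup>\<sim>)"
    using assms tinv_closed by (simp add: r_distr m_comm)
  finally show ?thesis
    using assms tinv_mult_tinv_tinv by simp
qed

lemma inv_ring_hom_field:
  assumes "one_totalized_field K" and h: "h \<in> ring_hom R K"
  shows "inv_ring_hom R K h"
proof -
  interpret K: one_totalized_field K by fact
  interpret ring_hom_cring R K h
    by unfold_locales (rule h)
  have "h (x\<^sup>\<sim>) = (h x)\<^sup>\<sim>\<^bsub>K\<^esub>" if x: "x \<in> carrier R" for x
  proof (cases "h x = \<zero>\<^bsub>K\<^esub>")
    case True
    \<comment> \<open>Once \<open>h x\<close> is zero, the image of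
      \<open>mult_tinv_complement\<close> reduces to \<open>h (x\<^sup>\<sim>)\<close> being one,
      the value of \<open>tinv\<close> at zero in \<open>K\<close>.\<close>
    then show ?thesis
      using arg_cong[OF mult_tinv_complement[OF x], of h] x
      by (simp add: tinv_closed K.tinv_zero minus_eq K.minus_eq)
  next
    case False
    have "h x \<otimes>\<^bsub>K\<^esub> (h x \<otimes>\<^bsub>K\<^esub> h (x\<^sup>\<sim>)) = h x"
      using arg_cong[OF mult_mult_tinv[OF x], of h] x by (simp add: tinv_closed)
    \<comment> \<open>Multiplying by the inverse in \<open>K\<close> cancels one factor
      \<open>h x\<close>, which leaves \<open>h (x\<^sup>\<sim>)\<close> as an inverse of
      \<open>h x\<close>.\<close>
    then have "(h x)\<^sup>\<sim>\<^bsub>K\<^esub> \<otimes>\<^bsub>K\<^esub> h x \<otimes>\<^bsub>K\<^esub> (h x \<otimes>\<^bsub>K\<^esub> h (x\<^sup>\<sim>)) = (h x)\<^sup>\<sim>\<^bsub>K\<^esub> \<otimes>\<^bsub>K\<^esub> h x"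
      using x by (simp add: tinv_closed K.tinv_closed K.m_assoc)
    then have "h x \<otimes>\<^bsub>K\<^esub> h (x\<^sup>\<sim>) = \<one>\<^bsub>K\<^esub>"
      using x False K.general_inverse[of "h x"]
      by (simp add: tinv_closed K.tinv_closed K.m_comm[of "(h x)\<^sup>\<sim>\<^bsub>K\<^esub>"])
    then show ?thesis
      using x by (intro K.tinv_unique[symmetric]) (simp_all add: tinv_closed)
  qed
  then show ?thesis
    by unfold_locales (simp_all add: tinv_closed)
qed

lemma residue_field_separates:
  assumes d: "d \<in> carrier R" "d \<noteq> \<zero>"
  shows "\<exists>(K :: 'a set inv_ring) h. one_totalized_field K \<and> h \<in> ring_hom R K \<and> h d \<noteq> \<zero>\<^bsub>K\<^esub>"
proof -
  define e where "e = d \<otimes> d\<^sup>\<sim>"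
  have e: "e \<in> carrier R" "d \<otimes> e = d" "\<one> \<ominus> e \<in> carrier R"
    using d tinv_closed mult_mult_tinv by (simp_all add: e_def)
  have "d \<otimes> (\<one> \<ominus> e) = \<zero>"
    using d e by (simp add: minus_eq r_distr r_minus r_neg)
  \<comment> \<open>If \<open>\<one>\<close> were a multiple of \<open>\<one> \<ominus> e\<close>,
    then \<open>d\<close>, which annihilates \<open>\<one> \<ominus> e\<close>, would be
    zero.\<close>
  have "\<one> \<notin> PIdl (\<one> \<ominus> e)"
  proof
    assume "\<one> \<in> PIdl (\<one> \<ominus> e)"
    then obtain y where y: "y \<in> carrier R" "\<one> = y \<otimes> (\<one> \<ominus> e)"
      by (auto simp: cgenideal_def)
    then have "d = d \<otimes> (y \<otimes> (\<one> \<ominus> e))"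
      using d by simp
    also have "\<dots> = y \<otimes> (d \<otimes> (\<one> \<ominus> e))"
      using d e y(1) by (intro m_lcomm)
    finally show False
      using \<open>d \<otimes> (\<one> \<ominus> e) = \<zero>\<close> d y(1) by simp
  qed
  then obtain M where M: "maximalideal M R" "PIdl (\<one> \<ominus> e) \<subseteq> M"
    using exists_maximalideal cgenideal_ideal e by blast
  interpret M: maximalideal M R by fact
  \<comment> \<open>Otherwise \<open>M\<close> would contain \<open>e\<close> as well as
    \<open>\<one> \<ominus> e\<close>, hence their sum \<open>\<one>\<close>.\<close>
  have "d \<notin> M"
  proof
    assume "d \<in> M"
    then have "e \<in> M"
      using M.I_r_closed d tinv_closed by (simp add: e_def)
    moreover have "\<one> \<ominus> e \<in> M"
      using M(2) cgenideal_self e by blast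
    ultimately have "(\<one> \<ominus> e) \<oplus> e \<in> M"
      by blast
    then have "\<one> \<in> M"
      using e by (simp add: minus_eq a_assoc l_neg)
    then show False
      using M.I_notcarr M.one_imp_carrier by blast
  qed
  then have "M +> d \<noteq> \<zero>\<^bsub>totalize (R Quot M)\<^esub>"
    using d M.rcos_const_imp_mem by (auto simp: totalize_def FactRing_def)
  moreover have "(+>) M \<in> ring_hom R (totalize (R Quot M))"
    using M.rcos_ring_hom by (auto simp: totalize_def ring_hom_def)
  moreover have "one_totalized_field (totalize (R Quot M))"
    using M.quotient_is_field is_cring by (intro one_totalized_field_totalize)
  ultimately show ?thesis
    by blast
qed

text \<open>The separation result is applied to the difference of the two sides at a refuting
  \<open>\<rho>\<close>; then \<open>h \<circ> \<rho>\<close> refutes the equation in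
  \<open>K\<close>. Elements of the residue field are cosets, whence the type
  \<open>'a set\<close>.\<close>

lemma not_satisfies_imp_residue_field:
  assumes "\<not> satisfies R e"
  shows "\<exists>K :: 'a set inv_ring. one_totalized_field K \<and> \<not> satisfies K e"
proof -
  obtain \<rho> where \<rho>: "range \<rho> \<subseteq> carrier R" "eval R \<rho> (fst e) \<noteq> eval R \<rho> (snd e)"
    using assms by (auto simp: satisfies_def)
  let ?s = "eval R \<rho> (fst e)" and ?t = "eval R \<rho> (snd e)"
  have st: "?s \<in> carrier R" "?t \<in> carrier R"
    using eval_closed[OF is_cring tinv_closed \<rho>(1)] by simp_all
  then have "?s \<ominus> ?t \<noteq> \<zero>"
    using \<rho>(2) r_right_minus_eq by blast
  then obtain K :: "'a set inv_ring" and h where K: "one_totalized_field K"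
    and h: "h \<in> ring_hom R K" "h (?s \<ominus> ?t) \<noteq> \<zero>\<^bsub>K\<^esub>"
    using residue_field_separates st minus_closed by meson
  interpret inv_ring_hom R K h
    using K h(1) by (rule inv_ring_hom_field)
  have "h ?s \<noteq> h ?t"
    using h(2) st by (auto simp: minus_eq S.r_neg)
  then have "\<not> satisfies K e"
    using \<rho>(1) hom_eval[OF \<rho>(1)] unfolding satisfies_def
    by (metis (no_types, lifting) comp_apply hom_closed image_subset_iff)
  then show ?thesis
    using K by blast
qed

end

section \<open>Equality of the two theories across carrier types\<close>

theorem theorem4:
  assumes "infinite (UNIV :: 'a set)"
    and "infinite (UNIV :: 'b set)"
  shows "(meadow_equational_theory TYPE('a) :: 'v equation set) =
    one_totalized_field_equational_theory TYPE('b)"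
proof (intro equalityI subsetI)
  fix e :: "'v equation"
  assume e: "e \<in> meadow_equational_theory TYPE('a)"
  have "satisfies R e" if R: "one_totalized_field R" for R :: "'b inv_ring"
  proof (rule ccontr)
    assume "\<not> satisfies R e"
    \<comment> \<open>The refuting field lives over \<open>'b\<close>, whereas \<open>e\<close> is
      known for meadows over \<open>'a\<close>, so a copy over \<open>'a\<close> is needed.\<close>
    then obtain S :: "'a inv_ring" where S: "one_totalized_field S" "\<not> satisfies S e"
      using one_totalized_field_copy[OF R _ assms(1)] by blast
    interpret one_totalized_field S by fact
    show False
      using e S(2) one_based_noninvolutive_meadow_axioms
      by (auto simp: meadow_equational_theory_def)
  qed
  then show "e \<in> one_totalized_field_equational_theory TYPE('b)"
    by (simp add: one_totalized_field_equational_theory_def)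
next
  fix e :: "'v equation"
  assume e: "e \<in> one_totalized_field_equational_theory TYPE('b)"
  have "satisfies R e" if R: "one_based_noninvolutive_meadow R" for R :: "'a inv_ring"
  proof (rule ccontr)
    assume "\<not> satisfies R e"
    then obtain K :: "'a set inv_ring" where "one_totalized_field K" "\<not> satisfies K e"
      using one_based_noninvolutive_meadow.not_satisfies_imp_residue_field[OF R] by blast
    \<comment> \<open>The residue field over \<open>'a set\<close> is replaced by a countable copy
      over \<open>'b\<close>, where \<open>e\<close> is assumed to hold.\<close>
    then obtain S :: "'b inv_ring" where "one_totalized_field S" "\<not> satisfies S e"
      using one_totalized_field_copy assms(2) by blast
    then show False
      using e by (auto simp: one_totalized_field_equational_theory_def)
  qed
  then show "e \<in> meadow_equational_theory TYPE('a)"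
    by (simp add: meadow_equational_theory_def)
qed

end
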